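(* Let $\Delta_1,\Delta_2$ be vertex transitive graphs on $m_1$, $m_2$ vertices, respectively, and let $\Gamma = \Delta_1 * \Delta_2$ be a product graph on $m_1m_2$ vertices, where $*$ stands for $\square$, $\times$, or $\boxtimes$, and let $f$ be the corresponding function: $f(\lambda,\mu) = \lambda+\mu$ for $\square$, $f(\lambda,\mu)=\lambda\mu$ for $\times$, $f(\lambda,\mu) = (\lambda+1)(\mu+1)-1$ for $\boxtimes$. Let $\nu$ be an eigenvalue of $\Gamma$ and let $(\lambda_i,\mu_i)$, $1\le i\le k$, be all the distinct pairs consisting of an eigenvalue $\lambda_i$ of $\Delta_1$ and an eigenvalue $\mu_i$ of $\Delta_2$ such that $\nu = f(\lambda_i,\mu_i)$. Assume that all $\lambda_i,\mu_i$ are rational, and let $L_{\Delta_1,\lambda_i}$ and $L_{\Delta_2,\mu_i}$, $1\le i\le k$, be the corresponding lattices. Then $L_{\Gamma,\nu}$ is the orthogonal projection of $\mathbb{Z}^{m_1m_2}$ onto the real subspace spanned by $$\left(L_{\Delta_1,\lambda_1}\otimes_{\mathbb{Z}} L_{\Delta_2,\mu_1}\right)\oplus\cdots\oplus\left(L_{\Delta_1,\lambda_k}\otimes_{\mathbb{Z}} L_{\Delta_2,\mu_k}\right),$$ where $\oplus$ is the orthogonal direct sum. In particular, if $k=1$ then $L_{\Gamma,\nu} = L_{\Delta_1,\lambda_1}\otimes_{\mathbb{Z}} L_{\Delta_2,\mu_1}$, up to similarity.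
   Context: Graphs are finite and simple; eigenvalues of a graph are the eigenvalues of its adjacency matrix. A graph is vertex transitive if its automorphism group acts transitively on its vertices. For a vertex transitive graph $\Delta$ on $n$ vertices and a rational eigenvalue $\lambda$, with $P_{\Delta,\lambda}$ the orthogonal projection of $\mathbb{R}^n$ onto the $\lambda$-eigenspace of the adjacency matrix, put $L_{\Delta,\lambda} := P_{\Delta,\lambda}\mathbb{Z}^n$, a lattice of full rank in that eigenspace. Products: each of the following graphs has as vertices the pairs $(u,v)$ with $u$ a vertex of $\Delta_1$ and $v$ a vertex of $\Delta_2$. Cartesian product $\Delta_1\square\Delta_2$: $(u_1,v_1)$ and $(u_2,v_2)$ are adjacent iff either $u_1=u_2$ and $v_1,v_2$ are adjacent in $\Delta_2$, or $v_1=v_2$ and $u_1,u_2$ are adjacent in $\Delta_1$. Direct product $\Delta_1\times\Delta_2$: adjacent iff $u_1,u_2$ are adjacent in $\Delta_1$ and $v_1,v_2$ are adjacent in $\Delta_2$. Strong product $\Delta_1\boxtimes\Delta_2$: two distinct vertices are adjacent iff $u_1,u_2$ are equal or adjacent in $\Delta_1$ and $v_1,v_2$ are equal or adjacent in $\Delta_2$. The space $\mathbb{R}^{m_1m_2}$ indexed by vertices of $\Gamma$ is identified with $\mathbb{R}^{m_1}\otimes_{\mathbb{R}}\mathbb{R}^{m_2}$ via $e_{(u,v)} = e_u\otimes e_v$ (Kronecker product), with its standard inner product. For lattices $L_1\subset\mathbb{R}^{m_1}$, $L_2\subset\mathbb{R}^{m_2}$ (not necessarily of full rank), $L_1\otimes_{\mathbb{Z}}L_2$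 is the $\mathbb{Z}$-span of $\{x\otimes y : x\in L_1, y\in L_2\}$ in $\mathbb{R}^{m_1m_2}$. Two lattices $L$, $M$ are similar if $L=\alpha UM$ for a nonzero real scalar $\alpha$ and an orthogonal transformation $U$. *)

theory Defs
  imports "HOL-Analysis.Analysis"
begin

text \<open>A graph is given by its adjacency relation on a type of class \<open>finite\<close>, the type of its vertices.\<close>

type_synonym 'v graph = "'v \<Rightarrow> 'v \<Rightarrow> bool"

definition simple_graph :: "'v graph \<Rightarrow> bool" where
  "simple_graph E \<longleftrightarrow> symp E \<and> irreflp E"

definition graph_automorphism :: "'v graph \<Rightarrow> ('v \<Rightarrow> 'v) \<Rightarrow> bool" where
  "graph_automorphism E \<phi> \<longleftrightarrow> bij \<phi> \<and> (\<forall>u v. E (\<phi> u) (\<phi> v) \<longleftrightarrow> E u v)"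

definition vertex_transitive :: "'v graph \<Rightarrow> bool" where
  "vertex_transitive E \<longleftrightarrow> (\<forall>u v. \<exists>\<phi>. graph_automorphism E \<phi> \<and> \<phi> u = v)"

definition adj_matrix :: "'v::finite graph \<Rightarrow> real^'v^'v" where
  "adj_matrix E = (\<chi> u v. if E u v then 1 else 0)"

definition eigenspace :: "'v::finite graph \<Rightarrow> real \<Rightarrow> (real^'v) set" where
  "eigenspace E l = {x. adj_matrix E *v x = l *\<^sub>R x}"

definition graph_eigenvalue :: "'v::finite graph \<Rightarrow> real \<Rightarrow> bool" where
  "graph_eigenvalue E l \<longleftrightarrow> (\<exists>x. x \<noteq> 0 \<and> adj_matrix E *v x = l *\<^sub>R x)"

definition orth_proj :: "'a::euclidean_space set \<Rightarrow> 'a \<Rightarrow> 'a" where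
  "orth_proj S x = (THE y. y \<in> S \<and> (\<forall>z\<in>S. orthogonal (x - y) z))"

lemma ex1_orth_proj:
  fixes S :: "'a::euclidean_space set"
  assumes "subspace S"
  shows "\<exists>!y. y \<in> S \<and> (\<forall>z\<in>S. orthogonal (x - y) z)"
proof -
  have sp: "span S = S"
    using assms by (simp add: span_eq_iff)
  obtain y z where yz: "y \<in> span S" "\<And>w. w \<in> span S \<Longrightarrow> orthogonal z w" "x = y + z"
    using orthogonal_subspace_decomp_exists[of S x] by blast
  show ?thesis
  proof (rule ex1I[of _ y])
    show "y \<in> S \<and> (\<forall>z\<in>S. orthogonal (x - y) z)"
      using yz sp by auto
    fix y' assume y': "y' \<in> S \<and> (\<forall>z\<in>S. orthogonal (x - y') z)"
    have mem: "y' - y \<in> S"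
      using y' yz(1) sp assms by (simp add: subspace_diff)
    have "orthogonal (x - y) (y' - y)" "orthogonal (x - y') (y' - y)"
      using mem y' yz sp by auto
    then have "(y' - y) \<bullet> (y' - y) = 0"
      by (simp add: orthogonal_def inner_diff_left)
    then show "y' = y" by simp
  qed
qed

definition int_lattice :: "(real^'n) set" where
  "int_lattice = {x. \<forall>i. x $ i \<in> \<int>}"

definition eigen_lattice :: "'v::finite graph \<Rightarrow> real \<Rightarrow> (real^'v) set" where
  "eigen_lattice E l = orth_proj (eigenspace E l) ` int_lattice"

datatype graph_product = Cartesian | Direct | Strong

fun product_graph :: "graph_product \<Rightarrow> 'a graph \<Rightarrow> 'b graph \<Rightarrow> ('a \<times> 'b) graph" where
  "product_graph Cartesian E F (u1, v1) (u2, v2) \<longleftrightarrow>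
     u1 = u2 \<and> F v1 v2 \<or> v1 = v2 \<and> E u1 u2"
| "product_graph Direct E F (u1, v1) (u2, v2) \<longleftrightarrow> E u1 u2 \<and> F v1 v2"
| "product_graph Strong E F (u1, v1) (u2, v2) \<longleftrightarrow>
     (u1, v1) \<noteq> (u2, v2) \<and> (u1 = u2 \<or> E u1 u2) \<and> (v1 = v2 \<or> F v1 v2)"

fun product_fun :: "graph_product \<Rightarrow> real \<Rightarrow> real \<Rightarrow> real" where
  "product_fun Cartesian l m = l + m"
| "product_fun Direct l m = l * m"
| "product_fun Strong l m = (l + 1) * (m + 1) - 1"

lemma simple_graph_product:
  assumes "simple_graph E" "simple_graph F"
  shows "simple_graph (product_graph p E F)"
  using assms by (cases p) (auto simp: simple_graph_def symp_def irreflp_def)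

lemma vertex_transitive_product:
  assumes "vertex_transitive E" "vertex_transitive F"
  shows "vertex_transitive (product_graph p E F)"
  unfolding vertex_transitive_def
proof (intro allI)
  fix x y :: "'a \<times> 'b"
  obtain f g where f: "graph_automorphism E f" "f (fst x) = fst y"
    and g: "graph_automorphism F g" "g (snd x) = snd y"
    using assms unfolding vertex_transitive_def by meson
  have inj: "f a = f b \<longleftrightarrow> a = b" "g c = g d \<longleftrightarrow> c = d" for a b c d
    using f(1) g(1) by (auto simp: graph_automorphism_def bij_def inj_eq)
  have "bij (map_prod f g)"
    using f(1) g(1) by (auto simp: graph_automorphism_def bij_def prod.inj_map map_prod_surj)
  then have "graph_automorphism (product_graph p E F) (map_prod f g)"
    using f(1) g(1) inj by (cases p) (auto simp: graph_automorphism_def)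
  then show "\<exists>\<phi>. graph_automorphism (product_graph p E F) \<phi> \<and> \<phi> x = y"
    using f(2) g(2) by (intro exI[of _ "map_prod f g"]) (cases x; cases y; simp)
qed

lemma product_fun_Rats:
  "l \<in> \<rat> \<Longrightarrow> m \<in> \<rat> \<Longrightarrow> product_fun p l m \<in> \<rat>"
  by (cases p) auto

text \<open>The Kronecker product, under the identification of the basis vector indexed by \<open>(u, v)\<close>
  with the tensor product of those indexed by \<open>u\<close> and \<open>v\<close>.\<close>

definition tensor_vec :: "real^'a \<Rightarrow> real^'b \<Rightarrow> real^('a::finite \<times> 'b::finite)" where
  "tensor_vec x y = (\<chi> p. x $ fst p * y $ snd p)"

lemma tensor_vec_axis:
  "tensor_vec (axis u 1) (axis v 1) = axis (u, v) 1"
  by (auto simp: vec_eq_iff tensor_vec_def axis_def)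

definition int_span :: "'a::real_vector set \<Rightarrow> 'a set" where
  "int_span = module.span (\<lambda>(k::int) x. of_int k *\<^sub>R x)"

lemma module_int_scaleR: "module (\<lambda>(k::int) (x::'a::real_vector). of_int k *\<^sub>R x)"
  by unfold_locales (simp_all add: scaleR_add_right scaleR_add_left)

definition tensor_lattice ::
    "(real^'a::finite) set \<Rightarrow> (real^'b::finite) set \<Rightarrow> (real^('a \<times> 'b)) set" where
  "tensor_lattice L M = int_span {tensor_vec x y | x y. x \<in> L \<and> y \<in> M}"

definition orthogonal_sets :: "'a::real_inner set \<Rightarrow> 'a set \<Rightarrow> bool" where
  "orthogonal_sets L M \<longleftrightarrow> (\<forall>x\<in>L. \<forall>y\<in>M. orthogonal x y)"

text \<open>The summands are required to be pairwise orthogonal, hence the sum is direct. The sum of the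
  sets \<open>L i\<close> is the elementwise one from \<open>Set_Algebras\<close>.\<close>

definition is_orthogonal_direct_sum :: "'i set \<Rightarrow> ('i \<Rightarrow> 'a::real_inner set) \<Rightarrow> 'a set \<Rightarrow> bool" where
  "is_orthogonal_direct_sum I L S \<longleftrightarrow>
     pairwise (\<lambda>i j. orthogonal_sets (L i) (L j)) I \<and> S = (\<Sum>i\<in>I. L i)"

definition similar_lattices :: "'a::real_inner set \<Rightarrow> 'a set \<Rightarrow> bool" where
  "similar_lattices L M \<longleftrightarrow>
     (\<exists>\<alpha> U. \<alpha> \<noteq> 0 \<and> orthogonal_transformation U \<and> L = (\<lambda>x. \<alpha> *\<^sub>R U x) ` M)"

end

theory Submission
  imports Defs
begin

text \<open>The tensor products of eigenvectors of the two factors are eigenvectors of the product graph,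
  and by the spectral theorem they span the whole space. As eigenspaces of a symmetric matrix are
  pairwise orthogonal, the eigenspace for \<open>\<nu>\<close> is spanned by the tensor products whose eigenvalues
  satisfy \<open>f(\<lambda>, \<mu>) = \<nu>\<close>. For a single pair the orthogonal projection is the tensor product of the
  projections of the two factors, which carries the standard basis to generators of the tensor
  product of the two lattices; the similarity is then an equality.\<close>

section \<open>Orthogonal projections\<close>

text \<open>Uniqueness from \<open>ex1_orth_proj\<close> lets a projection be computed by exhibiting
  a point of \<open>S\<close> whose residual is orthogonal to \<open>S\<close>.\<close>

lemma orth_proj_eqI:
  assumes "subspace S" "y \<in> S" "\<And>z. z \<in> S \<Longrightarrow> orthogonal (x - y) z"
  shows "orth_proj S x = y"
  unfolding orth_proj_def by (rule the1_equality[OF ex1_orth_proj]) (use assms in auto)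

lemma
  assumes "subspace S"
  shows orth_proj_in: "orth_proj S x \<in> S"
    and orthogonal_orth_proj: "z \<in> S \<Longrightarrow> orthogonal (x - orth_proj S x) z"
  using theI'[OF ex1_orth_proj[OF assms, of x]] unfolding orth_proj_def by auto

text \<open>Both conditions that characterise the projection are preserved by sums and scalar
  multiples, so uniqueness gives additivity and homogeneity.\<close>

lemma linear_orth_proj:
  assumes "subspace S"
  shows "linear (orth_proj S)"
proof (rule linearI)
  note P = orth_proj_in[OF assms] orthogonal_orth_proj[OF assms]
  show "orth_proj S (x + y) = orth_proj S x + orth_proj S y" for x y
  proof (rule orth_proj_eqI[OF assms])
    show "orthogonal (x + y - (orth_proj S x + orth_proj S y)) z" if "z \<in> S" for z
      using P(2)[OF that, of x] P(2)[OF that, of y]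
      by (simp add: orthogonal_def algebra_simps)
  qed (simp add: P assms subspace_add)
  show "orth_proj S (r *\<^sub>R x) = r *\<^sub>R orth_proj S x" for r x
  proof (rule orth_proj_eqI[OF assms])
    show "orthogonal (r *\<^sub>R x - r *\<^sub>R orth_proj S x) z" if "z \<in> S" for z
      using P(2)[OF that, of x] by (simp add: orthogonal_def algebra_simps)
  qed (simp add: P assms subspace_scale)
qed

lemma orth_proj_id:
  assumes "subspace S" "x \<in> S"
  shows "orth_proj S x = x"
  by (rule orth_proj_eqI) (use assms in \<open>auto simp: orthogonal_def\<close>)

section \<open>The spectral theorem for real symmetric matrices\<close>

lemma symmetric_matrix_inner:
  fixes A :: "real^'n^'n"
  assumes "transpose A = A"
  shows "(A *v x) \<bullet> y = x \<bullet> (A *v y)"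
  by (metis assms dot_lmul_matrix transpose_matrix_vector)

lemma symmetric_eigenvectors_orthogonal:
  fixes A :: "real^'n^'n"
  assumes "transpose A = A" "A *v x = l *\<^sub>R x" "A *v y = m *\<^sub>R y" "l \<noteq> m"
  shows "orthogonal x y"
proof -
  have "l * (x \<bullet> y) = m * (x \<bullet> y)"
    using symmetric_matrix_inner[OF assms(1), of x y] assms(2,3) by simp
  with assms(4) show ?thesis by (simp add: orthogonal_def)
qed

text \<open>The eigenvector is a maximiser of the Rayleigh quotient on \<open>S\<close>.\<close>

lemma symmetric_matrix_eigenvector_in_subspace:
  fixes A :: "real^'n^'n"
  assumes sym: "transpose A = A" and sub: "subspace S" and ne: "S \<noteq> {0}"
    and inv: "\<And>x. x \<in> S \<Longrightarrow> A *v x \<in> S"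
  obtains v c where "v \<in> S" "v \<noteq> 0" "A *v v = c *\<^sub>R v"
proof -
  have "compact (S \<inter> sphere 0 1)"
    using closed_subspace[OF sub] by (simp add: compact_Int_closed closed_Int_compact)
  moreover have "S \<inter> sphere 0 1 \<noteq> {}"
  proof -
    obtain x where "x \<in> S" "x \<noteq> 0" using ne subspace_0[OF sub] by blast
    then have "(1 / norm x) *\<^sub>R x \<in> S \<inter> sphere 0 1"
      using sub by (simp add: subspace_scale)
    then show ?thesis by blast
  qed
  moreover have "continuous_on (S \<inter> sphere 0 1) (\<lambda>x. x \<bullet> (A *v x))"
    by (intro continuous_intros linear_continuous_on)
       (simp add: matrix_vector_mul_bounded_linear)
  ultimately obtain v where "v \<in> S \<inter> sphere 0 1"
    and "\<forall>x \<in> S \<inter> sphere 0 1. x \<bullet> (A *v x) \<le> v \<bullet> (A *v v)"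
    using continuous_attains_sup[of "S \<inter> sphere 0 1" "\<lambda>x. x \<bullet> (A *v x)"] by blast
  then have v: "v \<in> S" "norm v = 1"
    and max: "\<And>x. x \<in> S \<Longrightarrow> norm x = 1 \<Longrightarrow> x \<bullet> (A *v x) \<le> v \<bullet> (A *v v)"
    by simp_all
  define c where "c = v \<bullet> (A *v v)"
  \<comment> \<open>\<open>Q\<close> is the defect in the Rayleigh inequality: by homogeneity it is
    nonnegative on all of \<open>S\<close>, and it vanishes at the maximiser
    \<open>v\<close>.\<close>
  define Q where "Q x = c * (x \<bullet> x) - x \<bullet> (A *v x)" for x
  have Q_nonneg: "Q x \<ge> 0" if "x \<in> S" for x
  proof (cases "x = 0")
    case False
    let ?y = "(1 / norm x) *\<^sub>R x"
    have "?y \<bullet> (A *v ?y) \<le> c"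
      unfolding c_def by (rule max) (use False that sub in \<open>auto simp: subspace_scale\<close>)
    then have "x \<bullet> (A *v x) / (norm x)\<^sup>2 \<le> c"
      by (simp add: matrix_vector_mult_scaleR power2_eq_square)
    with False show ?thesis
      by (simp add: Q_def divide_simps flip: power2_norm_eq_inner)
  qed (simp add: Q_def)
  \<comment> \<open>\<open>w\<close> is half the gradient of \<open>Q\<close> at \<open>v\<close>;
    since \<open>v\<close> minimises \<open>Q\<close> on \<open>S\<close>, it should vanish, which
    is the eigenvector equation with eigenvalue \<open>c\<close>.\<close>
  define w where "w = c *\<^sub>R v - A *v v"
  have w: "w \<in> S"
    unfolding w_def using v inv sub by (simp add: subspace_diff subspace_scale)
  \<comment> \<open>The constant term is \<open>Q v = 0\<close>, so the linear term dominates for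
    small \<open>t\<close> and would make \<open>Q\<close> negative for some negative
    \<open>t\<close> unless \<open>w \<bullet> w = 0\<close>.\<close>
  have quad: "Q (v + t *\<^sub>R w) = 2 * t * (w \<bullet> w) + t\<^sup>2 * Q w" for t
  proof -
    have wAv: "w \<bullet> (A *v v) = c * (w \<bullet> v) - w \<bullet> w"
      by (simp add: w_def algebra_simps)
    then have vAw: "v \<bullet> (A *v w) = c * (w \<bullet> v) - w \<bullet> w"
      using symmetric_matrix_inner[OF sym, of v w] by (simp add: inner_commute)
    have vv: "v \<bullet> v = 1" using v(2) by (simp add: norm_eq_1)
    have vAv: "v \<bullet> (A *v v) = c" by (simp add: c_def)
    have "Q (v + t *\<^sub>R w) = c * (v \<bullet> v + 2 * t * (w \<bullet> v) + t\<^sup>2 * (w \<bullet> w))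
        - (v \<bullet> (A *v v) + t * (v \<bullet> (A *v w)) + t * (w \<bullet> (A *v v)) + t\<^sup>2 * (w \<bullet> (A *v w)))"
      by (simp add: Q_def matrix_vector_right_distrib matrix_vector_mult_scaleR inner_add_left
          inner_add_right inner_commute[of v w] power2_eq_square algebra_simps)
    then show ?thesis
      unfolding vAw wAv vv vAv Q_def by (simp add: algebra_simps)
  qed
  have "w \<bullet> w = 0"
  proof -
    define D B where "D = w \<bullet> w" and "B = Q w"
    have B: "B \<ge> 0" using Q_nonneg w by (simp add: B_def)
    \<comment> \<open>The denominator \<open>B + 1\<close> is positive even when
      \<open>B = 0\<close>. Substituting \<open>D = - t * (B + 1)\<close> turns the quadratic into
      minus a square times \<open>B + 2\<close>, which forces \<open>t = 0\<close>.\<close>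
    define t where "t = - D / (B + 1)"
    have tB: "t * (B + 1) = - D" using B by (simp add: t_def)
    have "0 \<le> 2 * t * D + t\<^sup>2 * B"
      using Q_nonneg[of "v + t *\<^sub>R w"] v w sub quad[of t]
      by (simp add: subspace_add subspace_scale D_def B_def)
    also have "\<dots> = - t\<^sup>2 * (B + 2)"
      using tB by (simp add: power2_eq_square) algebra
    finally have "t\<^sup>2 * (B + 2) \<le> 0" by simp
    then have "t = 0" using B by (auto simp: mult_le_0_iff)
    then show ?thesis using tB by (simp add: D_def)
  qed
  then have "A *v v = c *\<^sub>R v" by (simp add: w_def)
  then show thesis using that v by force
qed

text \<open>By symmetry \<open>A\<close> preserves the orthogonal complement of the set of all
  eigenvectors. A nonzero complement would contain an eigenvector, which would then be orthogonal to
  itself.\<close>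

theorem span_eigenvectors_symmetric:
  fixes A :: "real^'n^'n"
  assumes sym: "transpose A = A"
  shows "span {x. \<exists>l. A *v x = l *\<^sub>R x} = UNIV"
proof -
  define V where "V = {x. \<exists>l. A *v x = l *\<^sub>R x}"
  define S where "S = {z. \<forall>x\<in>V. orthogonal x z}"
  have sub: "subspace S" by (simp add: S_def subspace_orthogonal_to_vectors)
  have "S = {0}"
  proof (rule ccontr)
    assume "S \<noteq> {0}"
    moreover have "A *v z \<in> S" if "z \<in> S" for z
    proof -
      have "x \<bullet> (A *v z) = 0" if "x \<in> V" for x
        using that \<open>z \<in> S\<close> symmetric_matrix_inner[OF sym, of x z]
        by (auto simp: S_def V_def orthogonal_def)
      then show ?thesis by (simp add: S_def orthogonal_def)
    qed
    ultimately obtain v c where v: "v \<in> S" "v \<noteq> 0" "A *v v = c *\<^sub>R v"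
      using symmetric_matrix_eigenvector_in_subspace[OF sym sub] by metis
    then have "v \<in> V" by (auto simp: V_def)
    with v(1) have "orthogonal v v" by (auto simp: S_def)
    with v(2) show False by (simp add: orthogonal_def)
  qed
  moreover have "x \<in> span V" for x
  proof -
    obtain y z where y: "y \<in> span V" and z: "\<And>w. w \<in> span V \<Longrightarrow> orthogonal z w" and "x = y + z"
      using orthogonal_subspace_decomp_exists[of V x] by blast
    have "z \<in> S" using z by (auto simp: S_def orthogonal_commute span_base)
    with \<open>S = {0}\<close> \<open>x = y + z\<close> y show ?thesis by simp
  qed
  ultimately show ?thesis by (auto simp: V_def)
qed

section \<open>Integral spans\<close>

lemma int_span_base: "x \<in> X \<Longrightarrow> x \<in> int_span X"
  unfolding int_span_def by (rule module.span_base[OF module_int_scaleR])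

lemma int_span_0: "0 \<in> int_span X"
  unfolding int_span_def by (rule module.span_zero[OF module_int_scaleR])

lemma int_span_scale: "x \<in> int_span X \<Longrightarrow> of_int k *\<^sub>R x \<in> int_span X"
  unfolding int_span_def by (rule module.span_scale[OF module_int_scaleR])

lemma int_span_sum: "(\<And>i. i \<in> I \<Longrightarrow> f i \<in> int_span X) \<Longrightarrow> sum f I \<in> int_span X"
  unfolding int_span_def by (rule module.span_sum[OF module_int_scaleR])

lemma int_span_minimal:
  assumes "X \<subseteq> M" "0 \<in> M" "\<And>x y. x \<in> M \<Longrightarrow> y \<in> M \<Longrightarrow> x + y \<in> M"
    and "\<And>k x. x \<in> M \<Longrightarrow> of_int k *\<^sub>R x \<in> M"
  shows "int_span X \<subseteq> M"
  unfolding int_span_def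
  by (rule module.span_minimal[OF module_int_scaleR])
     (use assms in \<open>auto simp: module.subspace_def[OF module_int_scaleR]\<close>)

lemma int_span_subset_span: "int_span X \<subseteq> span X"
  by (rule int_span_minimal) (auto simp: span_base span_zero span_add span_scale)

lemma axis_in_int_lattice: "axis i 1 \<in> int_lattice"
  by (auto simp: int_lattice_def axis_def)

text \<open>Integer vectors are exactly the integer combinations of the standard basis, and a linear
  map preserves such combinations. This supplies explicit generators for projected lattices.\<close>

lemma linear_image_int_lattice:
  fixes f :: "real^'n \<Rightarrow> 'a::real_vector"
  assumes "linear f"
  shows "f ` int_lattice = int_span (range (\<lambda>i. f (axis i 1)))"
proof
  interpret linear f by fact
  show "f ` int_lattice \<subseteq> int_span (range (\<lambda>i. f (axis i 1)))"
  proof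
    fix y assume "y \<in> f ` int_lattice"
    then obtain x where x: "x \<in> int_lattice" "y = f x" by blast
    have "x = (\<Sum>i\<in>UNIV. (x $ i) *\<^sub>R axis i 1)"
      by (simp add: basis_expansion flip: scalar_mult_eq_scaleR)
    then have "y = (\<Sum>i\<in>UNIV. (x $ i) *\<^sub>R f (axis i 1))"
      using x(2) by (metis (no_types, lifting) scale sum sum.cong)
    moreover have "(x $ i) *\<^sub>R f (axis i 1) \<in> int_span (range (\<lambda>i. f (axis i 1)))" for i
    proof -
      have "x $ i \<in> \<int>" using x(1) by (simp add: int_lattice_def)
      then obtain k where "x $ i = of_int k" by (rule Ints_cases)
      then show ?thesis by (simp add: int_span_scale int_span_base)
    qed
    ultimately show "y \<in> int_span (range (\<lambda>i. f (axis i 1)))"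
      by (auto intro: int_span_sum)
  qed
  show "int_span (range (\<lambda>i. f (axis i 1))) \<subseteq> f ` int_lattice"
  proof (rule int_span_minimal)
    show "range (\<lambda>i. f (axis i 1)) \<subseteq> f ` int_lattice"
      by (auto intro: axis_in_int_lattice)
    show "0 \<in> f ` int_lattice"
      by (rule image_eqI[of _ _ 0]) (auto simp: int_lattice_def)
    show "x + y \<in> f ` int_lattice" if "x \<in> f ` int_lattice" "y \<in> f ` int_lattice" for x y
      using that by (auto simp: int_lattice_def simp flip: add intro!: imageI)
    show "of_int k *\<^sub>R x \<in> f ` int_lattice" if "x \<in> f ` int_lattice" for k x
      using that by (auto simp: int_lattice_def simp flip: scale intro!: imageI)
  qed
qed

section \<open>Tensor products of vectors\<close>

lemma bilinear_tensor_vec: "bilinear tensor_vec"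
  unfolding bilinear_def
  by (auto intro!: linearI simp: tensor_vec_def vec_eq_iff algebra_simps)

lemmas tensor_vec_add_left = bilinear_ladd[OF bilinear_tensor_vec]
  and tensor_vec_add_right = bilinear_radd[OF bilinear_tensor_vec]
  and tensor_vec_scale_left = bilinear_lmul[OF bilinear_tensor_vec]
  and tensor_vec_scale_right = bilinear_rmul[OF bilinear_tensor_vec]

text \<open>The sum over pairs factors into two sums; hence orthogonality in either factor carries
  over to the tensors.\<close>

lemma inner_tensor_vec: "tensor_vec x y \<bullet> tensor_vec x' y' = (x \<bullet> x') * (y \<bullet> y')"
proof -
  have "tensor_vec x y \<bullet> tensor_vec x' y'
      = (\<Sum>(u, v)\<in>UNIV \<times> UNIV. (x $ u * x' $ u) * (y $ v * y' $ v))"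
    by (simp add: inner_vec_def tensor_vec_def case_prod_unfold mult_ac)
  also have "\<dots> = (x \<bullet> x') * (y \<bullet> y')"
    by (simp add: inner_vec_def sum_product sum.cartesian_product)
  finally show ?thesis .
qed

text \<open>Bilinearity is used one argument at a time: first \<open>y\<close> varies over the span
  of \<open>Y\<close> with a generator \<open>a\<close> fixed, then \<open>x\<close> varies with
  \<open>y\<close> fixed.\<close>

lemma tensor_vec_in_span:
  assumes "x \<in> span X" "y \<in> span Y"
  shows "tensor_vec x y \<in> span {tensor_vec a b | a b. a \<in> X \<and> b \<in> Y}" (is "_ \<in> span ?T")
proof -
  have lin: "linear (\<lambda>x. tensor_vec x y)" "linear (tensor_vec x)" for x y
    using bilinear_tensor_vec by (auto simp: bilinear_def)
  have "tensor_vec a y \<in> span ?T" if "a \<in> X" for a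
  proof -
    have "tensor_vec a y \<in> span (tensor_vec a ` Y)"
      using assms(2) linear_span_image[OF lin(2)] by blast
    moreover have "tensor_vec a ` Y \<subseteq> ?T" using that by blast
    ultimately show ?thesis using span_mono by blast
  qed
  then have "(\<lambda>x. tensor_vec x y) ` X \<subseteq> span ?T" by blast
  moreover have "tensor_vec x y \<in> span ((\<lambda>x. tensor_vec x y) ` X)"
    using assms(1) linear_span_image[OF lin(1)] by blast
  ultimately show ?thesis using span_minimal[OF _ subspace_span] by blast
qed

text \<open>Each standard basis vector of the product space is a tensor of standard basis vectors,
  and these lie in the two full spans.\<close>

lemma span_tensor_vec_UNIV:
  assumes "span X = UNIV" "span Y = UNIV"
  shows "span {tensor_vec a b | a b. a \<in> X \<and> b \<in> Y} = UNIV" (is "span ?T = UNIV")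
proof -
  have "axis p 1 \<in> span ?T" for p
    using tensor_vec_in_span[of "axis (fst p) 1" X "axis (snd p) 1" Y] assms
    by (simp add: tensor_vec_axis)
  then have "Basis \<subseteq> span ?T" by (auto simp: Basis_vec_def)
  then have "span Basis \<subseteq> span ?T" by (rule span_minimal) (rule subspace_span)
  then show ?thesis by auto
qed

section \<open>Kronecker products of matrices\<close>

definition kronecker :: "real^'a^'a \<Rightarrow> real^'b^'b \<Rightarrow> real^('a::finite \<times> 'b::finite)^('a \<times> 'b)" where
  "kronecker A B = (\<chi> p q. A $ fst p $ fst q * B $ snd p $ snd q)"

text \<open>The sum over index pairs factors. Together with \<open>adj_matrix_product\<close> this
  treats all three graph products by one rule.\<close>

lemma kronecker_mult_tensor_vec:
  "kronecker A B *v tensor_vec x y = tensor_vec (A *v x) (B *v y)"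
proof -
  have "(\<Sum>q\<in>UNIV. A $ u $ fst q * B $ v $ snd q * (x $ fst q * y $ snd q))
      = (\<Sum>s\<in>UNIV. A $ u $ s * x $ s) * (\<Sum>t\<in>UNIV. B $ v $ t * y $ t)" for u v
  proof -
    have "(\<Sum>q\<in>UNIV. A $ u $ fst q * B $ v $ snd q * (x $ fst q * y $ snd q))
        = (\<Sum>(s, t)\<in>UNIV \<times> UNIV. (A $ u $ s * x $ s) * (B $ v $ t * y $ t))"
      by (simp add: case_prod_unfold mult_ac)
    also have "\<dots> = (\<Sum>s\<in>UNIV. A $ u $ s * x $ s) * (\<Sum>t\<in>UNIV. B $ v $ t * y $ t)"
      by (simp add: sum_product sum.cartesian_product)
    finally show ?thesis .
  qed
  then show ?thesis
    by (simp add: vec_eq_iff kronecker_def tensor_vec_def matrix_vector_mult_def)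
qed

section \<open>Eigenspaces of graphs\<close>

lemma transpose_adj_matrix: "simple_graph E \<Longrightarrow> transpose (adj_matrix E) = adj_matrix E"
  by (auto simp: vec_eq_iff transpose_def adj_matrix_def simple_graph_def dest: sympD)

lemma subspace_eigenspace: "subspace (eigenspace E l)"
  by (auto simp: subspace_def eigenspace_def matrix_vector_right_distrib
      matrix_vector_mult_scaleR scaleR_add_right)

lemma orthogonal_eigenspaces:
  assumes "simple_graph E" "x \<in> eigenspace E l" "y \<in> eigenspace E m" "l \<noteq> m"
  shows "orthogonal x y"
  using symmetric_eigenvectors_orthogonal[OF transpose_adj_matrix] assms
  unfolding eigenspace_def by blast

lemma span_eigenspaces: "simple_graph E \<Longrightarrow> span (\<Union>l. eigenspace E l) = UNIV"
  using span_eigenvectors_symmetric[OF transpose_adj_matrix, of E]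
  by (simp add: eigenspace_def UNION_eq)

lemma eigen_lattice_subset: "eigen_lattice E l \<subseteq> eigenspace E l"
  by (auto simp: eigen_lattice_def intro: orth_proj_in subspace_eigenspace)

lemma orthogonal_eigen_lattices:
  assumes "simple_graph E" "l \<noteq> m"
  shows "orthogonal_sets (eigen_lattice E l) (eigen_lattice E m)"
  unfolding orthogonal_sets_def
proof (intro ballI)
  fix x y assume "x \<in> eigen_lattice E l" "y \<in> eigen_lattice E m"
  then have "x \<in> eigenspace E l" "y \<in> eigenspace E m"
    using eigen_lattice_subset by auto
  then show "orthogonal x y"
    by (rule orthogonal_eigenspaces[OF assms(1) _ _ assms(2)])
qed

text \<open>The integer lattice contains a basis, so its real span is everything, and the linear
  projection maps that span onto the eigenspace.\<close>

lemma span_eigen_lattice: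
  fixes E :: "'v::finite graph"
  shows "span (eigen_lattice E l) = eigenspace E l"
proof
  let ?P = "orth_proj (eigenspace E l)"
  note lin = linear_orth_proj[OF subspace_eigenspace[of E l]]
  show "span (eigen_lattice E l) \<subseteq> eigenspace E l"
    by (intro span_minimal eigen_lattice_subset subspace_eigenspace)
  show "eigenspace E l \<subseteq> span (eigen_lattice E l)"
  proof
    fix x assume x: "x \<in> eigenspace E l"
    have "Basis \<subseteq> (int_lattice :: (real^'v) set)"
      by (auto simp: Basis_vec_def axis_in_int_lattice)
    then have "span (int_lattice :: (real^'v) set) = UNIV"
      by (metis span_Basis span_mono top.extremum_uniqueI)
    then have "range ?P = span (?P ` int_lattice)"
      by (simp add: linear_span_image[OF lin])
    moreover have "?P x = x" using x by (simp add: orth_proj_id subspace_eigenspace)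
    ultimately show "x \<in> span (eigen_lattice E l)"
      unfolding eigen_lattice_def by (metis rangeI)
  qed
qed

section \<open>Spectra of product graphs\<close>

text \<open>Irreflexivity makes the two Cartesian cases exclusive, so no entry of the sum is 2. For
  the strong product, adding \<open>mat 1\<close> encodes "equal or adjacent", again with entries 0
  and 1, and the subtracted identity matrix removes the loops.\<close>

lemma adj_matrix_product:
  fixes E :: "'a::finite graph" and F :: "'b::finite graph"
  assumes "simple_graph E" "simple_graph F"
  shows "adj_matrix (product_graph Cartesian E F)
           = kronecker (mat 1) (adj_matrix F) + kronecker (adj_matrix E) (mat 1)"
    and "adj_matrix (product_graph Direct E F) = kronecker (adj_matrix E) (adj_matrix F)"
    and "adj_matrix (product_graph Strong E F)
           = kronecker (adj_matrix E + mat 1) (adj_matrix F + mat 1) - kronecker (mat 1) (mat 1)"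
  using assms
  by (auto simp: vec_eq_iff adj_matrix_def kronecker_def mat_def simple_graph_def irreflp_def)

lemma tensor_vec_in_eigenspace:
  assumes "simple_graph E" "simple_graph F" "x \<in> eigenspace E l" "y \<in> eigenspace F m"
  shows "tensor_vec x y \<in> eigenspace (product_graph p E F) (product_fun p l m)"
proof -
  have "adj_matrix E *v x = l *\<^sub>R x" "adj_matrix F *v y = m *\<^sub>R y"
    using assms by (auto simp: eigenspace_def)
  then show ?thesis
    by (cases p)
       (simp_all add: eigenspace_def adj_matrix_product[OF assms(1,2)] matrix_vector_mult_add_rdistrib
         matrix_vector_mult_diff_rdistrib kronecker_mult_tensor_vec tensor_vec_add_left
         tensor_vec_add_right tensor_vec_scale_left tensor_vec_scale_right algebra_simps)
qed

text \<open>Let \<open>z\<close> be the component of an eigenvector \<open>x\<close> orthogonal to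
  the span. It still lies in the eigenspace of \<open>n\<close>, so it is orthogonal to tensors
  belonging to other eigenvalues, and to the remaining ones by choice. Tensors of eigenvectors span
  the whole space, hence \<open>z = 0\<close>.\<close>

lemma eigenspace_product:
  assumes "simple_graph E" "simple_graph F"
  shows "eigenspace (product_graph p E F) n =
    span {tensor_vec x y | x y. \<exists>l m. x \<in> eigenspace E l \<and> y \<in> eigenspace F m \<and> n = product_fun p l m}"
    (is "?G n = span ?T")
proof
  have T: "?T \<subseteq> ?G n"
    using tensor_vec_in_eigenspace[OF assms] by blast
  then show T': "span ?T \<subseteq> ?G n"
    by (intro span_minimal subspace_eigenspace)
  show "?G n \<subseteq> span ?T"
  proof
    fix x assume x: "x \<in> ?G n"
    obtain y z where y: "y \<in> span ?T" and z: "\<And>w. w \<in> span ?T \<Longrightarrow> orthogonal z w" and xyz: "x = y + z"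
      using orthogonal_subspace_decomp_exists[of ?T x] by blast
    have "z = x - y" using xyz by simp
    then have zG: "z \<in> ?G n"
      using x y T' subspace_diff[OF subspace_eigenspace] by blast
    have "orthogonal z (tensor_vec a b)" if "a \<in> eigenspace E l" "b \<in> eigenspace F m" for a b l m
    proof (cases "n = product_fun p l m")
      case True
      then have "tensor_vec a b \<in> ?T" using that by blast
      then show ?thesis by (intro z span_base)
    next
      case False
      then show ?thesis
        by (rule orthogonal_eigenspaces[OF simple_graph_product[OF assms] zG
              tensor_vec_in_eigenspace[OF assms that]])
    qed
    then have "orthogonal z w"
      if "w \<in> span {tensor_vec a b | a b. a \<in> (\<Union>l. eigenspace E l) \<and> b \<in> (\<Union>m. eigenspace F m)}" for w
      by - (rule orthogonal_to_span[OF that], blast)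
    then have "orthogonal z z"
      using span_tensor_vec_UNIV[OF span_eigenspaces[OF assms(1)] span_eigenspaces[OF assms(2)]]
      by blast
    then show "x \<in> span ?T" using xyz y by (simp add: orthogonal_def)
  qed
qed

text \<open>A vector and its projection have equal inner products with the subspace. Applied in both
  factors, this makes the residual orthogonal to every generating tensor.\<close>

lemma orth_proj_tensor_vec:
  assumes "subspace V" "subspace W"
  shows "orth_proj (span {tensor_vec x y | x y. x \<in> V \<and> y \<in> W}) (tensor_vec a b)
    = tensor_vec (orth_proj V a) (orth_proj W b)"
proof (rule orth_proj_eqI)
  let ?a = "orth_proj V a" and ?b = "orth_proj W b"
  show "tensor_vec ?a ?b \<in> span {tensor_vec x y | x y. x \<in> V \<and> y \<in> W}"
    using orth_proj_in[OF assms(1)] orth_proj_in[OF assms(2)] by (intro span_base) blast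
  have "(tensor_vec a b - tensor_vec ?a ?b) \<bullet> tensor_vec x y = 0" if "x \<in> V" "y \<in> W" for x y
  proof -
    have "a \<bullet> x = ?a \<bullet> x" "b \<bullet> y = ?b \<bullet> y"
      using orthogonal_orth_proj[OF assms(1) that(1), of a] orthogonal_orth_proj[OF assms(2) that(2), of b]
      by (auto simp: orthogonal_def inner_diff_left)
    then show ?thesis by (simp add: inner_diff_left inner_tensor_vec)
  qed
  then show "orthogonal (tensor_vec a b - tensor_vec ?a ?b) z"
    if "z \<in> span {tensor_vec x y | x y. x \<in> V \<and> y \<in> W}" for z
    by - (rule orthogonal_to_span[OF that], auto simp: orthogonal_def)
qed (rule subspace_span)

section \<open>Tensor products of lattices\<close>

lemma tensor_lattice_subset_span:
  "tensor_lattice L M \<subseteq> span {tensor_vec x y | x y. x \<in> L \<and> y \<in> M}"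
  unfolding tensor_lattice_def by (rule int_span_subset_span)

lemma zero_in_tensor_lattice: "0 \<in> tensor_lattice L M"
  unfolding tensor_lattice_def by (rule int_span_0)

text \<open>Inner products of tensors multiply, so one vanishing factor suffices. Orthogonality of
  generators then extends to the real spans, one argument at a time.\<close>

lemma orthogonal_tensor_lattices:
  assumes "orthogonal_sets L L' \<or> orthogonal_sets M M'"
  shows "orthogonal_sets (tensor_lattice L M) (tensor_lattice L' M')"
  unfolding orthogonal_sets_def
proof (intro ballI)
  let ?T = "{tensor_vec x y | x y. x \<in> L \<and> y \<in> M}" and ?T' = "{tensor_vec x y | x y. x \<in> L' \<and> y \<in> M'}"
  fix x y assume "x \<in> tensor_lattice L M" "y \<in> tensor_lattice L' M'"
  then have x: "x \<in> span ?T" and y: "y \<in> span ?T'" using tensor_lattice_subset_span by blast+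
  have "orthogonal s t" if "s \<in> ?T" "t \<in> ?T'" for s t
    using that assms by (auto simp: orthogonal_sets_def orthogonal_def inner_tensor_vec)
  then have "orthogonal s y" if "s \<in> ?T" for s
    using that by (intro orthogonal_to_span[OF y])
  then have "orthogonal y x"
    by (intro orthogonal_to_span[OF x]) (simp add: orthogonal_commute)
  then show "orthogonal x y" by (simp add: orthogonal_commute)
qed

text \<open>The left side is generated by projections of standard basis vectors, which are tensors
  of projected basis vectors. Conversely, a tensor of projections of integer vectors
  \<open>a\<close> and \<open>b\<close> is the projection of the integer vector
  \<open>tensor_vec a b\<close>.\<close>

lemma orth_proj_tensor_int_lattice:
  fixes V :: "(real^'a) set" and W :: "(real^'b) set"
  assumes "subspace V" "subspace W"
  shows "orth_proj (span {tensor_vec x y | x y. x \<in> V \<and> y \<in> W}) ` int_lattice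
    = tensor_lattice (orth_proj V ` int_lattice) (orth_proj W ` int_lattice)" (is "?P ` _ = _")
proof
  have lin: "linear ?P" by (simp add: linear_orth_proj)
  have P: "?P (tensor_vec a b) = tensor_vec (orth_proj V a) (orth_proj W b)" for a b
    by (rule orth_proj_tensor_vec[OF assms])
  have Pim: "?P ` int_lattice = int_span (range (\<lambda>i. ?P (axis i 1)))"
    by (rule linear_image_int_lattice[OF lin])
  let ?L = "{tensor_vec x y | x y. x \<in> orth_proj V ` int_lattice \<and> y \<in> orth_proj W ` int_lattice}"
  have "?P (axis i 1) \<in> ?L" for i
  proof -
    have "?P (axis i 1) = tensor_vec (orth_proj V (axis (fst i) 1)) (orth_proj W (axis (snd i) 1))"
      using P[of "axis (fst i) 1" "axis (snd i) 1"] by (simp add: tensor_vec_axis)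
    then show ?thesis by (auto intro: imageI axis_in_int_lattice)
  qed
  then have "range (\<lambda>i. ?P (axis i 1)) \<subseteq> ?L" by blast
  then show "?P ` int_lattice \<subseteq> tensor_lattice (orth_proj V ` int_lattice) (orth_proj W ` int_lattice)"
    unfolding Pim tensor_lattice_def int_span_def
    by (rule module.span_mono[OF module_int_scaleR])
  have "?L \<subseteq> ?P ` int_lattice"
  proof clarify
    fix a :: "real^'a" and b :: "real^'b" assume "a \<in> int_lattice" "b \<in> int_lattice"
    then have "tensor_vec a b \<in> int_lattice" by (auto simp: int_lattice_def tensor_vec_def)
    then show "tensor_vec (orth_proj V a) (orth_proj W b) \<in> ?P ` int_lattice"
      unfolding P[symmetric] by (rule imageI)
  qed
  \<comment> \<open>By \<open>Pim\<close> the projected lattice is itself an integral span, so it is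
    enough that it contains the generators \<open>?L\<close>.\<close>
  then have "int_span ?L \<subseteq> int_span (range (\<lambda>i. ?P (axis i 1)))"
    unfolding Pim int_span_def
    by (rule module.span_minimal[OF module_int_scaleR _ module.subspace_span[OF module_int_scaleR]])
  then show "tensor_lattice (orth_proj V ` int_lattice) (orth_proj W ` int_lattice) \<subseteq> ?P ` int_lattice"
    unfolding Pim tensor_lattice_def .
qed

section \<open>Elementwise sums of sets\<close>

lemma sum_sets_superset:
  fixes L :: "'i \<Rightarrow> 'a::comm_monoid_add set"
  assumes "finite I" "\<And>i. i \<in> I \<Longrightarrow> 0 \<in> L i" "j \<in> I"
  shows "L j \<subseteq> (\<Sum>i\<in>I. L i)"
proof
  fix x assume "x \<in> L j"
  \<comment> \<open>The chosen decomposition puts \<open>x\<close> in the summand \<open>j\<close>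
    and 0 in all the others.\<close>
  then have "(\<Sum>i\<in>I. if i = j then x else 0) \<in> (\<Sum>i\<in>I. L i)"
    unfolding set_sum_alt[OF assms(1)] using assms(2)
    by (intro CollectI exI[of _ "\<lambda>i. if i = j then x else 0"]) auto
  then show "x \<in> (\<Sum>i\<in>I. L i)" using assms by simp
qed

lemma sum_sets_subset_subspace:
  assumes "finite I" "subspace V" "\<And>i. i \<in> I \<Longrightarrow> L i \<subseteq> V"
  shows "(\<Sum>i\<in>I. L i) \<subseteq> V"
  using assms by (auto simp: set_sum_alt intro!: subspace_sum)

section \<open>The lattice of a product graph\<close>

theorem theorem4p4:
  fixes \<Delta>1 :: "'a::finite graph" and \<Delta>2 :: "'b::finite graph"
    and p :: graph_product
    and \<Gamma> :: "('a \<times> 'b) graph"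
    and \<nu> :: real and k :: nat and lam mu :: "nat \<Rightarrow> real"
  assumes "simple_graph \<Delta>1" and "vertex_transitive \<Delta>1"
    and "simple_graph \<Delta>2" and "vertex_transitive \<Delta>2"
    and "\<Gamma> = product_graph p \<Delta>1 \<Delta>2"
    and "graph_eigenvalue \<Gamma> \<nu>"
    and "bij_betw (\<lambda>i. (lam i, mu i)) {1..k}
           {(l, m). graph_eigenvalue \<Delta>1 l \<and> graph_eigenvalue \<Delta>2 m \<and> \<nu> = product_fun p l m}"
    and "\<forall>i\<in>{1..k}. lam i \<in> \<rat> \<and> mu i \<in> \<rat>"
  shows "(\<exists>S. is_orthogonal_direct_sum {1..k}
                (\<lambda>i. tensor_lattice (eigen_lattice \<Delta>1 (lam i)) (eigen_lattice \<Delta>2 (mu i))) S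
            \<and> eigen_lattice \<Gamma> \<nu> = orth_proj (span S) ` int_lattice)
       \<and> (k = 1 \<longrightarrow>
            similar_lattices (eigen_lattice \<Gamma> \<nu>)
              (tensor_lattice (eigen_lattice \<Delta>1 (lam 1)) (eigen_lattice \<Delta>2 (mu 1))))"
proof -
  note simple = assms(1,3)
  define V where "V i = eigenspace \<Delta>1 (lam i)" for i
  define W where "W i = eigenspace \<Delta>2 (mu i)" for i
  define L where "L i = tensor_lattice (eigen_lattice \<Delta>1 (lam i)) (eigen_lattice \<Delta>2 (mu i))" for i
  define T where "T i = {tensor_vec x y | x y. x \<in> V i \<and> y \<in> W i}" for i
  have pairs: "\<nu> = product_fun p (lam i) (mu i)" if "i \<in> {1..k}" for i
    using bij_betw_apply[OF assms(7) that] by simp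
  have inj: "inj_on (\<lambda>i. (lam i, mu i)) {1..k}"
    using assms(7) by (rule bij_betw_imp_inj_on)

  have eig: "eigenspace \<Gamma> \<nu> = span (\<Union>i\<in>{1..k}. T i)"
  proof
    have "T i \<subseteq> eigenspace \<Gamma> \<nu>" if "i \<in> {1..k}" for i
      using tensor_vec_in_eigenspace[OF simple] pairs[OF that] assms(5)
      by (auto simp: T_def V_def W_def)
    then show "span (\<Union>i\<in>{1..k}. T i) \<subseteq> eigenspace \<Gamma> \<nu>"
      by (intro span_minimal subspace_eigenspace) blast
    have "tensor_vec x y \<in> span (\<Union>i\<in>{1..k}. T i)"
      if x: "x \<in> eigenspace \<Delta>1 l" and y: "y \<in> eigenspace \<Delta>2 m" and lm: "\<nu> = product_fun p l m" for x y l m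
    \<comment> \<open>The enumeration lists only pairs of genuine eigenvalues, and nonzero
      \<open>x\<close> and \<open>y\<close> certify that \<open>l\<close> and \<open>m\<close> are
      such; otherwise the tensor is zero.\<close>
    proof (cases "x = 0 \<or> y = 0")
      case True
      then have "tensor_vec x y = 0" by (auto simp: tensor_vec_def vec_eq_iff)
      then show ?thesis by (simp add: span_zero)
    next
      case False
      then have "graph_eigenvalue \<Delta>1 l" "graph_eigenvalue \<Delta>2 m"
        using x y by (auto simp: graph_eigenvalue_def eigenspace_def)
      then have "(l, m) \<in> (\<lambda>i. (lam i, mu i)) ` {1..k}"
        using assms(7) lm by (auto simp: bij_betw_def)
      then obtain i where "i \<in> {1..k}" "lam i = l" "mu i = m" by blast
      then have "tensor_vec x y \<in> T i" using x y by (auto simp: T_def V_def W_def)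
      with \<open>i \<in> {1..k}\<close> show ?thesis by (intro span_base) blast
    qed
    then show "eigenspace \<Gamma> \<nu> \<subseteq> span (\<Union>i\<in>{1..k}. T i)"
      unfolding assms(5) eigenspace_product[OF simple]
      by (intro span_minimal subspace_span) blast
  qed

  have "pairwise (\<lambda>i j. orthogonal_sets (L i) (L j)) {1..k}"
  proof (rule pairwiseI)
    fix i j assume "i \<in> {1..k}" "j \<in> {1..k}" "i \<noteq> j"
    \<comment> \<open>Distinct pairs may share one component, but they differ in the other, and
      orthogonality comes from that factor.\<close>
    then have "lam i \<noteq> lam j \<or> mu i \<noteq> mu j" using inj_onD[OF inj, of i j] by blast
    then have "orthogonal_sets (eigen_lattice \<Delta>1 (lam i)) (eigen_lattice \<Delta>1 (lam j))
        \<or> orthogonal_sets (eigen_lattice \<Delta>2 (mu i)) (eigen_lattice \<Delta>2 (mu j))"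
      using orthogonal_eigen_lattices[OF simple(1)] orthogonal_eigen_lattices[OF simple(2)] by blast
    then show "orthogonal_sets (L i) (L j)"
      unfolding L_def by (rule orthogonal_tensor_lattices)
  qed
  then have sum: "is_orthogonal_direct_sum {1..k} L (\<Sum>i\<in>{1..k}. L i)"
    by (simp add: is_orthogonal_direct_sum_def)
  \<comment> \<open>Once the sum of the lattices is known to span the eigenspace, the projection in
    the claim is the one that defines \<open>eigen_lattice\<close>.\<close>
  have span: "span (\<Sum>i\<in>{1..k}. L i) = eigenspace \<Gamma> \<nu>"
  proof
    have "L i \<subseteq> span (T i)" for i
      using tensor_lattice_subset_span[of "eigen_lattice \<Delta>1 (lam i)" "eigen_lattice \<Delta>2 (mu i)"]
        span_mono[of "{tensor_vec x y | x y. x \<in> eigen_lattice \<Delta>1 (lam i) \<and> y \<in> eigen_lattice \<Delta>2 (mu i)}" "T i"]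
        eigen_lattice_subset[of \<Delta>1 "lam i"] eigen_lattice_subset[of \<Delta>2 "mu i"]
      unfolding L_def T_def V_def W_def by blast
    moreover have "span (T i) \<subseteq> eigenspace \<Gamma> \<nu>" if "i \<in> {1..k}" for i
      unfolding eig using that by (intro span_mono) blast
    ultimately show "span (\<Sum>i\<in>{1..k}. L i) \<subseteq> eigenspace \<Gamma> \<nu>"
      by (intro span_minimal sum_sets_subset_subspace subspace_eigenspace finite_atLeastAtMost) blast
    \<comment> \<open>Lattice vectors span each factor eigenspace, so tensors of eigenvectors lie in
      the real span of tensors of lattice vectors. These belong to \<open>L i\<close>, which sits
      inside the sum because every summand contains 0.\<close>
    have "T i \<subseteq> span (\<Sum>i\<in>{1..k}. L i)" if i: "i \<in> {1..k}" for i
    proof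
      fix t assume "t \<in> T i"
      then obtain x y where t: "t = tensor_vec x y"
        and "x \<in> span (eigen_lattice \<Delta>1 (lam i))" "y \<in> span (eigen_lattice \<Delta>2 (mu i))"
        unfolding T_def V_def W_def span_eigen_lattice by blast
      then have "t \<in> span {tensor_vec a b | a b. a \<in> eigen_lattice \<Delta>1 (lam i) \<and> b \<in> eigen_lattice \<Delta>2 (mu i)}"
        using tensor_vec_in_span by blast
      moreover have "{tensor_vec a b | a b. a \<in> eigen_lattice \<Delta>1 (lam i) \<and> b \<in> eigen_lattice \<Delta>2 (mu i)} \<subseteq> L i"
        unfolding L_def tensor_lattice_def by (blast intro: int_span_base)
      moreover have "L i \<subseteq> (\<Sum>i\<in>{1..k}. L i)"
        by (rule sum_sets_superset) (use i in \<open>auto simp: L_def zero_in_tensor_lattice\<close>)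
      ultimately show "t \<in> span (\<Sum>i\<in>{1..k}. L i)" by (meson span_mono subset_iff)
    qed
    then show "eigenspace \<Gamma> \<nu> \<subseteq> span (\<Sum>i\<in>{1..k}. L i)"
      unfolding eig by (intro span_minimal subspace_span) blast
  qed
  have similar: "similar_lattices (eigen_lattice \<Gamma> \<nu>) (L 1)" if "k = 1"
  proof -
    \<comment> \<open>For a single pair the union collapses to \<open>T 1\<close>, the span handled
      by \<open>orth_proj_tensor_int_lattice\<close>.\<close>
    have "eigenspace \<Gamma> \<nu> = span (T 1)" using eig that by simp
    then have "eigen_lattice \<Gamma> \<nu> = L 1"
      unfolding L_def eigen_lattice_def T_def V_def W_def
      by (simp add: orth_proj_tensor_int_lattice subspace_eigenspace)
    then show ?thesis
      unfolding similar_lattices_def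
      by (intro exI[of _ 1] exI[of _ "\<lambda>x. x"]) simp
  qed
  have "eigen_lattice \<Gamma> \<nu> = orth_proj (span (\<Sum>i\<in>{1..k}. L i)) ` int_lattice"
    unfolding span eigen_lattice_def ..
  with sum have "\<exists>S. is_orthogonal_direct_sum {1..k} L S
      \<and> eigen_lattice \<Gamma> \<nu> = orth_proj (span S) ` int_lattice"
    by blast
  with similar show ?thesis
    unfolding L_def by blast
qed

end
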